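(* Let $d\ge2$ be an integer and $D>0$ real. Then $r(d,D)$ is the largest $r$ for which $|f(ri)|=1$ holds for some $f\in K(d,D)$. Furthermore, $$r(d,D)\le\frac{d^{1/(d-1)}}{2D^{1/(d(d-1))}},$$ and: (i) if $d\ge2$ and $1\le D\le 2^{1-d}d^d$, then $2^{-1+2/d}d^{-1/(d-1)}\le r(d,D)\le d^{1/(d-1)}/2$; (ii) if $D=D_d>0$ depends on $d$ in such a way that $\lim_{d\to\infty}|\log D|/d^2=0$, then $\lim_{d\to\infty}r(d,D)=1/2$; (iii) if $D=D_d>0$ depends on $d$ in such a way that $\lim_{d\to\infty}(\log D)/d^2=\infty$, then $\lim_{d\to\infty}r(d,D)=0$.
   Context: For a monic polynomial $f(x)=\prod_{k=1}^d(x-x_k)$ the discriminant is $\Delta_f=\prod_{1\le j<k\le d}(x_j-x_k)^2$. $K(d,D)$ denotes the set of monic polynomials of degree $d$ in $\mathbb{R}[x]$ all of whose $d$ roots (counted with multiplicity) are real and whose discriminant equals $D$. For a polynomial $f$, $E(f):=\{z\in\mathbb{C}:|f(z)|\le1\}$ is its filled-in lemniscate. $r(d,D)$ denotes the largest possible radius of a closed disk with center on the real line that is contained in $E(f)$, among all $f\in K(d,D)$. Here $i=\sqrt{-1}$. *)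

theory Defs
  imports "HOL-Analysis.Analysis" "HOL-Computational_Algebra.Polynomial"
begin

text \<open>The discriminant of the monic polynomial with roots \<open>x 1, \<dots>, x d\<close> (repeated according
  to multiplicity).\<close>

definition discr :: "nat \<Rightarrow> (nat \<Rightarrow> real) \<Rightarrow> real" where
  "discr d x = (\<Prod>k=1..d. \<Prod>j=1..<k. (x j - x k)\<^sup>2)"

text \<open>The roots of a polynomial are unique up to reordering and \<open>discr\<close> is symmetric, so the
  discriminant condition does not depend on the enumeration \<open>x\<close>.\<close>

definition K :: "nat \<Rightarrow> real \<Rightarrow> real poly set" where
  "K d D = {f. \<exists>x. f = (\<Prod>k=1..d. [:- x k, 1:]) \<and> discr d x = D}"

definition lemniscate :: "complex poly \<Rightarrow> complex set" where
  "lemniscate f = {z. cmod (poly f z) \<le> 1}"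

definition disk_radii :: "nat \<Rightarrow> real \<Rightarrow> real set" where
  "disk_radii d D = {r. r > 0 \<and> (\<exists>f\<in>K d D. \<exists>c::real.
     cball (complex_of_real c) r \<subseteq> lemniscate (map_poly complex_of_real f))}"

definition is_largest :: "real set \<Rightarrow> real \<Rightarrow> bool" where
  "is_largest S r \<longleftrightarrow> r \<in> S \<and> (\<forall>s\<in>S. s \<le> r)"

text \<open>This is meaningful only if a largest radius exists.\<close>

definition max_radius :: "nat \<Rightarrow> real \<Rightarrow> real" where
  "max_radius d D = (THE r. is_largest (disk_radii d D) r)"

end

theory Submission
  imports Defs "HOL-Real_Asymp.Real_Asymp"
begin

text \<open>For \<open>f \<in> K d D\<close> with roots \<open>x k\<close> we have \<open>|f(ri)|\<^sup>2 = \<Prod>(r\<^sup>2 + (x k)\<^sup>2)\<close>, which increases with \<open>r\<close>, and a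
  largest \<open>r\<close> with \<open>|f(ri)| = 1\<close> exists by compactness. At the largest \<open>r\<close> no translate of \<open>f\<close> has a smaller
  value at \<open>ri\<close>, so \<open>\<Sum> 2 x k / (r\<^sup>2 + (x k)\<^sup>2) = 0\<close>. For \<open>|z| \<le> r\<close> and \<open>a = Re z\<close> this gives
  \<open>|f(z)|\<^sup>2 \<le> \<Prod>(r\<^sup>2 + (x k)\<^sup>2 - 2 a x k) \<le> |f(ri)|\<^sup>2 exp (- a \<Sum> 2 x k / (r\<^sup>2 + (x k)\<^sup>2)) = 1\<close>, so the
  whole disk of radius \<open>r\<close> about \<open>0\<close> lies in the lemniscate.

  With \<open>x k = r tan (t k)\<close> the discriminant is \<open>r^(d(d-1)) \<Prod>|sin (t j - t k)|\<close> divided by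
  \<open>(\<Prod>cos (t k))^(2(d-1))\<close>. Concavity of \<open>ln \<circ> sin\<close>, applied separately to each cyclic step \<open>m\<close> of the
  ordered angles, shows that the product of sines is largest for equally spaced angles; this yields
  \<open>r \<le> \<beta> = d^(1/(d-1)) / (2 D^(1/(d(d-1))))\<close>. Rotating the equally spaced angles realises every value of
  \<open>\<Prod>cos (t k)\<close> in \<open>(0, 2^(1-d)]\<close>, which yields \<open>r \<ge> min \<beta> (4^(1/d-1) / \<beta>)\<close>. The three parts follow from
  these two bounds.\<close>

section \<open>Real-rooted polynomials at complex points, and symmetries of the discriminant\<close>

lemma poly_of_real_prod_linear:
  assumes "finite A"
  shows "poly (map_poly complex_of_real (\<Prod>k\<in>A. [:- x k, 1:])) z = (\<Prod>k\<in>A. z - complex_of_real (x k))"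
  using assms
proof (induction rule: finite_induct)
  case empty
  then show ?case by simp
next
  case (insert a A)
  have mult: "map_poly complex_of_real (p * q) = map_poly complex_of_real p * map_poly complex_of_real q" for p q
    by (rule poly_eqI) (simp add: coeff_map_poly coeff_mult)
  show ?case
    using insert by (simp add: mult map_poly_pCons del: mult_pCons_left)
qed

lemma cmod_diff_of_real_sq: "(cmod (z - complex_of_real a))\<^sup>2 = (Re z - a)\<^sup>2 + (Im z)\<^sup>2"
  by (simp add: cmod_power2)

lemma cmod_poly_imaginary:
  fixes r :: real and d :: nat
  shows "cmod (poly (map_poly complex_of_real (\<Prod>k=1..d. [:- x k, 1:])) (complex_of_real r * \<i>)) = 1
     \<longleftrightarrow> (\<Prod>k=1..d. r\<^sup>2 + (x k)\<^sup>2) = 1"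
proof -
  let ?m = "cmod (poly (map_poly complex_of_real (\<Prod>k=1..d. [:- x k, 1:])) (complex_of_real r * \<i>))"
  have "?m = (\<Prod>k=1..d. cmod (complex_of_real r * \<i> - complex_of_real (x k)))"
    by (simp only: poly_of_real_prod_linear[OF finite_atLeastAtMost] prod_norm)
  then have "?m\<^sup>2 = (\<Prod>k=1..d. r\<^sup>2 + (x k)\<^sup>2)"
    by (simp add: prod_power_distrib cmod_diff_of_real_sq add.commute)
  moreover have "?m = 1 \<longleftrightarrow> ?m\<^sup>2 = 1"
    by (simp add: power2_eq_1_iff) (smt (verit) norm_ge_zero)
  ultimately show ?thesis by simp
qed

text \<open>Each unordered pair occurs in both orders on the right, so its square splits into two
  equal absolute values. The order-free form can be reindexed along any bijection.\<close>

lemma discr_eq_prod_pairs: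
  "discr d x = (\<Prod>j=1..d. \<Prod>k\<in>{1..d} - {j}. \<bar>x j - x k\<bar>)"
proof (induction d)
  case 0
  then show ?case by (simp add: discr_def)
next
  case (Suc d)
  have 1: "{1..Suc d} - {j} = insert (Suc d) ({1..d} - {j})" if "j \<in> {1..d}" for j
    using that by auto
  have 2: "{1..Suc d} - {Suc d} = {1..d}"
    by auto
  have "(\<Prod>j=1..Suc d. \<Prod>k\<in>{1..Suc d} - {j}. \<bar>x j - x k\<bar>)
      = (\<Prod>j=1..d. \<bar>x j - x (Suc d)\<bar> * (\<Prod>k\<in>{1..d} - {j}. \<bar>x j - x k\<bar>))
        * (\<Prod>k=1..d. \<bar>x (Suc d) - x k\<bar>)"
    using 1 by (simp add: 2 cong: prod.cong_simp del: One_nat_def)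
  also have "\<dots> = (\<Prod>j=1..d. \<bar>x j - x (Suc d)\<bar> * \<bar>x (Suc d) - x j\<bar>) * discr d x"
    by (simp add: prod.distrib Suc)
  also have "(\<Prod>j=1..d. \<bar>x j - x (Suc d)\<bar> * \<bar>x (Suc d) - x j\<bar>) = (\<Prod>j=1..d. (x j - x (Suc d))\<^sup>2)"
    by (intro prod.cong) (simp_all add: abs_minus_commute[of "x (Suc d)"] power2_eq_square flip: abs_mult)
  finally show ?case
    by (simp add: discr_def atLeastLessThanSuc_atLeastAtMost)
qed

lemma discr_scale: "discr d (\<lambda>k. t * x k) = t ^ (d * (d - 1)) * discr d x"
proof -
  have "discr d (\<lambda>k. t * x k) = (\<Prod>k=1..d. (t ^ 2) ^ (k - 1)) * discr d x"
    by (simp add: discr_def prod.distrib power_mult_distrib flip: right_diff_distrib)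
  also have "(\<Prod>k=1..d. (t ^ 2) ^ (k - 1)) = t ^ (\<Sum>k=1..d. 2 * (k - 1))"
    by (simp add: power_sum power_mult)
  also have "(\<Sum>k=1..d. 2 * (k - 1)) = d * (d - 1)"
    by (induction d) (auto simp: algebra_simps)
  finally show ?thesis .
qed

lemma discr_translate: "discr d (\<lambda>k. x k - t) = discr d x"
  by (simp add: discr_def)

subsection \<open>Existence of the largest radius\<close>

text \<open>The condition |f(ri)| = 1 in squared form, stated through the roots so that only real
  products occur. The sign of \<open>r\<close> is not restricted.\<close>

definition crossing_radii :: "nat \<Rightarrow> real \<Rightarrow> real set" where
  "crossing_radii d D = {r. \<exists>x. discr d x = D \<and> (\<Prod>k=1..d. r\<^sup>2 + (x k)\<^sup>2) = 1}"

lemma crossing_radii_eq: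
  "{r. \<exists>f\<in>K d D. cmod (poly (map_poly complex_of_real f) (complex_of_real r * \<i>)) = 1} = crossing_radii d D"
  unfolding crossing_radii_def K_def using cmod_poly_imaginary[where d = d] by blast

text \<open>The intermediate value theorem on \<open>{r..1}\<close>: at the right end every factor,
  hence the product, is at least 1.\<close>

lemma ex_crossing_radius_ge:
  assumes "d \<ge> 1" "r > 0" "discr d x = D" "(\<Prod>k=1..d. r\<^sup>2 + (x k)\<^sup>2) \<le> 1"
  shows "\<exists>s \<in> crossing_radii d D. s \<ge> r"
proof -
  let ?N = "\<lambda>s. \<Prod>k=1..d. s\<^sup>2 + (x k)\<^sup>2"
  \<comment> \<open>Every factor is at least \<open>r\<^sup>2\<close>, so a product of at most 1
    forces \<open>r \<le> 1\<close>.\<close>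
  have "(r\<^sup>2) ^ d = (\<Prod>k=1..d. r\<^sup>2)" by simp
  also have "\<dots> \<le> ?N r"
    by (rule prod_mono) auto
  also have "\<dots> \<le> 1" by fact
  finally have "r \<le> 1"
    using assms(1,2) by (simp add: power_le_one_iff abs_square_le_1)
  moreover have "1 \<le> ?N 1"
    by (rule prod_ge_1) auto
  ultimately obtain s where "r \<le> s" "?N s = 1"
    using IVT'[of ?N r 1 1] assms(4) by (force intro!: continuous_intros)
  then show ?thesis
    using assms(3) by (auto simp: crossing_radii_def)
qed

text \<open>Tychonoff's theorem for a product of copies of \<open>{-M..M}\<close>.\<close>

lemma compact_functions_bounded: "compact {x :: 'a \<Rightarrow> real. \<forall>k. \<bar>x k\<bar> \<le> M}"
proof -
  have "compactin (product_topology (\<lambda>i. euclidean) UNIV) (PiE UNIV (\<lambda>_::'a. {-M..M}))"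
    by (subst compactin_PiE) auto
  moreover have "a \<in> {-M..M} \<longleftrightarrow> \<bar>a\<bar> \<le> M" for a
    by auto
  then have "PiE UNIV (\<lambda>_::'a. {-M..M}) = {x. \<forall>k. \<bar>x k\<bar> \<le> M}"
    by (simp add: PiE_def Pi_def extensional_def del: atLeastAtMost_iff)
  ultimately show ?thesis
    by (simp add: euclidean_product_topology)
qed

text \<open>Away from radius 0 the crossing condition bounds both the radius and the roots. The
  admissible pairs of radius and roots thus form a compact set, and the first coordinate attains its
  maximum there.\<close>

lemma crossing_radii_has_max:
  assumes "d \<ge> 2" "r0 > 0" "r0 \<in> crossing_radii d D"
  obtains r where "r \<in> crossing_radii d D" "r > 0" "\<And>s. s \<in> crossing_radii d D \<Longrightarrow> s \<le> r"
proof -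
  define N where "N = (\<lambda>(s, x :: nat \<Rightarrow> real). \<Prod>k=1..d. s\<^sup>2 + (x k)\<^sup>2)"
  \<comment> \<open>If the product is 1 and the other \<open>d - 1\<close> factors are at least
    \<open>r0\<^sup>2\<close>, then \<open>\<bar>x k\<bar> \<le> 1 / r0 ^ (d - 1)\<close>.\<close>
  define M where "M = max 1 (1 / r0 ^ (d - 1))"
  define S where "S = {r0..1} \<times> {x :: nat \<Rightarrow> real. \<forall>k. \<bar>x k\<bar> \<le> M}"
  define T where "T = {p \<in> S. N p = 1 \<and> discr d (snd p) = D}"
  have coord: "continuous_on A (\<lambda>p. snd p k)" for A :: "(real \<times> (nat \<Rightarrow> real)) set" and k
    by (rule continuous_on_product_then_coordinatewise[where i = k]) (auto intro: continuous_intros)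
  have "compact S"
    unfolding S_def by (intro compact_Times compact_functions_bounded) auto
  moreover have "closed {p. N p = 1 \<and> discr d (snd p) = D}"
    unfolding N_def discr_def case_prod_beta
    by (intro closed_Collect_conj closed_Collect_eq continuous_intros coord)
  ultimately have "compact T"
    unfolding T_def using compact_Int_closed[of S] by (simp add: Collect_conj_eq)
  then have "compact (fst ` T)"
    by (intro compact_continuous_image continuous_intros)
  have in_T: "s \<in> fst ` T" if s: "s \<in> crossing_radii d D" "s \<ge> r0" for s
  proof -
    obtain x where x: "discr d x = D" "(\<Prod>k=1..d. s\<^sup>2 + (x k)\<^sup>2) = 1"
      using s(1) by (auto simp: crossing_radii_def)
    \<comment> \<open>Only the values at \<open>1..d\<close> are constrained; the default 0
      elsewhere puts the whole function into the bounded set.\<close>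
    define y where "y = (\<lambda>k. if k \<in> {1..d} then x k else 0)"
    have y: "discr d y = D" "(\<Prod>k=1..d. s\<^sup>2 + (y k)\<^sup>2) = 1"
    proof -
      show "discr d y = D"
        unfolding x(1)[symmetric] discr_def by (intro prod.cong) (auto simp: y_def)
      show "(\<Prod>k=1..d. s\<^sup>2 + (y k)\<^sup>2) = 1"
        unfolding x(2)[symmetric] by (intro prod.cong) (auto simp: y_def)
    qed
    have "s > 0" using s(2) assms(2) by simp
    have "s \<le> 1"
    proof (rule ccontr)
      assume "\<not> s \<le> 1"
      then have "1 < s\<^sup>2" by (simp add: one_less_power)
      then have "1 < (s\<^sup>2) ^ d" using assms(1) by (simp only: one_less_power)
      also have "(s\<^sup>2) ^ d = (\<Prod>k=1..d. s\<^sup>2)" by simp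
      also have "\<dots> \<le> (\<Prod>k=1..d. s\<^sup>2 + (y k)\<^sup>2)" by (rule prod_mono) auto
      finally show False using y(2) by simp
    qed
    have "\<bar>y k\<bar> \<le> M" for k
    proof (cases "k \<in> {1..d}")
      case False
      then show ?thesis by (auto simp: y_def M_def)
    next
      case True
      have "(y k)\<^sup>2 * (r0\<^sup>2) ^ (d - 1) = (y k)\<^sup>2 * (\<Prod>j\<in>{1..d} - {k}. r0\<^sup>2)"
        using True by simp
      also have "\<dots> \<le> (s\<^sup>2 + (y k)\<^sup>2) * (\<Prod>j\<in>{1..d} - {k}. s\<^sup>2 + (y j)\<^sup>2)"
        using s(2) assms(2)
        by (intro mult_mono prod_mono) (auto intro!: prod_nonneg add_increasing2 power_mono)
      also have "\<dots> = 1"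
        using y(2) True by (metis finite_atLeastAtMost prod.remove)
      finally have "(\<bar>y k\<bar> * r0 ^ (d - 1))\<^sup>2 \<le> 1\<^sup>2"
        unfolding power_mult_distrib by (metis mult.commute power2_abs power_mult power_one)
      then have "\<bar>y k\<bar> * r0 ^ (d - 1) \<le> 1"
        by (rule power2_le_imp_le) simp
      then show ?thesis
        using assms(2) by (simp add: M_def field_simps le_max_iff_disj)
    qed
    then have "(s, y) \<in> T"
      using y s(2) \<open>s \<le> 1\<close> by (simp add: T_def S_def N_def)
    then show ?thesis by force
  qed
  then have "fst ` T \<noteq> {}" using assms by blast
  with \<open>compact (fst ` T)\<close> obtain r where r: "r \<in> fst ` T" "\<And>s. s \<in> fst ` T \<Longrightarrow> s \<le> r"
    using compact_attains_sup by metis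
  show ?thesis
  proof
    show "r \<in> crossing_radii d D"
      using r(1) by (auto simp: T_def N_def crossing_radii_def)
    show "r > 0" using r(2)[OF in_T[OF assms(3)]] assms(2) by simp
    \<comment> \<open>A radius below \<open>r0\<close> is covered by \<open>r0 \<le> r\<close>;
      every other one is a first coordinate of \<open>T\<close>.\<close>
    show "s \<le> r" if "s \<in> crossing_radii d D" for s
      using r(2)[OF in_T[OF that]] r(2)[OF in_T[OF assms(3)]] by force
  qed
qed

text \<open>The topmost point of the disk lies in the lemniscate. Translating by \<open>c\<close>
  moves it onto the imaginary axis and preserves the discriminant.\<close>

lemma disk_radius_le_crossing_radius:
  assumes "d \<ge> 1" "s \<in> disk_radii d D"
  shows "\<exists>r \<in> crossing_radii d D. r \<ge> s"
proof -
  obtain x c where s: "s > 0" and x: "discr d x = D"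
    and sub: "cball (complex_of_real c) s
        \<subseteq> lemniscate (map_poly complex_of_real (\<Prod>k=1..d. [:- x k, 1:]))"
    using assms(2) by (auto simp: disk_radii_def K_def)
  let ?z = "complex_of_real c + complex_of_real s * \<i>"
  have "?z \<in> cball (complex_of_real c) s"
    using s by (simp add: dist_norm norm_mult)
  then have "cmod (\<Prod>k=1..d. ?z - complex_of_real (x k)) \<le> 1"
    using sub by (auto simp: lemniscate_def poly_of_real_prod_linear simp del: poly_prod)
  then have "(cmod (\<Prod>k=1..d. ?z - complex_of_real (x k)))\<^sup>2 \<le> 1"
    by (simp add: power_le_one)
  then have "(\<Prod>k=1..d. s\<^sup>2 + (x k - c)\<^sup>2) \<le> 1"
    by (simp add: cmod_diff_of_real_sq power2_commute[of "x _"] add.commute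
        prod_power_distrib flip: prod_norm)
  then show ?thesis
    using ex_crossing_radius_ge[OF assms(1) s, of "\<lambda>k. x k - c"] x by (simp add: discr_translate)
qed

text \<open>If a translate of the roots had product below 1 at \<open>r\<close>, some crossing
  radius would exceed \<open>r\<close>. So the logarithm \<open>L\<close> of the product is minimal
  at translation 0, and its derivative there is minus the sum in question.\<close>

lemma largest_crossing_radius_critical:
  assumes "d \<ge> 1" "r > 0" and max: "\<And>s. s \<in> crossing_radii d D \<Longrightarrow> s \<le> r"
    and x: "discr d x = D" "(\<Prod>k=1..d. r\<^sup>2 + (x k)\<^sup>2) = 1"
  shows "(\<Sum>k=1..d. 2 * x k / (r\<^sup>2 + (x k)\<^sup>2)) = 0"
proof -
  have pos: "r\<^sup>2 + y\<^sup>2 > 0" for y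
    using assms(2) by (simp add: add_pos_nonneg)
  define L where "L = (\<lambda>t. \<Sum>k=1..d. ln (r\<^sup>2 + (x k - t)\<^sup>2))"
  have L_eq: "L t = ln (\<Prod>k=1..d. r\<^sup>2 + (x k - t)\<^sup>2)" for t
    unfolding L_def by (rule ln_prod[symmetric]) (use pos in auto)
  have ge1: "1 \<le> (\<Prod>k=1..d. r\<^sup>2 + (x k - t)\<^sup>2)" for t
  proof (rule ccontr)
    let ?N = "\<lambda>s. \<Prod>k=1..d. s\<^sup>2 + (x k - t)\<^sup>2"
    assume "\<not> 1 \<le> ?N r"
    \<comment> \<open>By continuity the strict inequality persists slightly to the right of
      \<open>r\<close>.\<close>
    have "isCont ?N r"
      by (intro continuous_intros)
    then have "(?N \<longlongrightarrow> ?N r) (at_right r)"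
      by (simp add: isCont_def filterlim_at_split)
    then have "\<forall>\<^sub>F s in at_right r. ?N s < 1"
      using \<open>\<not> 1 \<le> ?N r\<close> by (intro order_tendstoD) auto
    then obtain s where "s > r" "?N s < 1"
      by (metis (no_types, lifting) eventually_at_right_field gt_ex dense)
    then obtain q where "q \<in> crossing_radii d D" "q \<ge> s"
      using ex_crossing_radius_ge[of d s "\<lambda>k. x k - t" D] assms by (force simp: discr_translate)
    then show False using max[of q] \<open>s > r\<close> by simp
  qed
  have "((\<lambda>t. ln (r\<^sup>2 + (x k - t)\<^sup>2)) has_real_derivative - 2 * x k / (r\<^sup>2 + (x k)\<^sup>2)) (at 0)" for k
    using pos[of "x k"] by (auto intro!: derivative_eq_intros)
  then have "(L has_real_derivative (\<Sum>k=1..d. - 2 * x k / (r\<^sup>2 + (x k)\<^sup>2))) (at 0)"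
    unfolding L_def by (intro DERIV_sum)
  moreover have "L 0 \<le> L t" for t
    using ge1[of t] x(2) by (simp add: L_eq)
  ultimately have "(\<Sum>k=1..d. - 2 * x k / (r\<^sup>2 + (x k)\<^sup>2)) = 0"
    using DERIV_local_min[of L _ 0 1] by simp
  then show ?thesis
    by (simp add: sum_negf)
qed

lemma largest_crossing_radius_disk:
  assumes "d \<ge> 1" "r > 0" and mem: "r \<in> crossing_radii d D"
    and max: "\<And>s. s \<in> crossing_radii d D \<Longrightarrow> s \<le> r"
  shows "r \<in> disk_radii d D"
proof -
  obtain x where x: "discr d x = D" "(\<Prod>k=1..d. r\<^sup>2 + (x k)\<^sup>2) = 1"
    using mem by (auto simp: crossing_radii_def)
  have pos: "r\<^sup>2 + y\<^sup>2 > 0" for y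
    using assms(2) by (simp add: add_pos_nonneg)
  have crit: "(\<Sum>k=1..d. 2 * x k / (r\<^sup>2 + (x k)\<^sup>2)) = 0"
    using largest_crossing_radius_critical[OF assms(1,2) max x] by simp
  have "cmod (\<Prod>k=1..d. z - complex_of_real (x k)) \<le> 1" if z: "cmod z \<le> r" for z
  proof -
    have "(cmod z)\<^sup>2 \<le> r\<^sup>2" using z by (simp add: power_mono)
    then have z2: "(Re z)\<^sup>2 + (Im z)\<^sup>2 \<le> r\<^sup>2" by (simp add: cmod_power2)
    have "(cmod (\<Prod>k=1..d. z - complex_of_real (x k)))\<^sup>2 = (\<Prod>k=1..d. (Re z - x k)\<^sup>2 + (Im z)\<^sup>2)"
      by (simp add: cmod_diff_of_real_sq prod_power_distrib flip: prod_norm)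
    also have "\<dots> \<le> (\<Prod>k=1..d. (r\<^sup>2 + (x k)\<^sup>2) * exp (- Re z * (2 * x k / (r\<^sup>2 + (x k)\<^sup>2))))"
    proof (rule prod_mono, safe)
      fix k
      have "(Re z - x k)\<^sup>2 + (Im z)\<^sup>2 \<le> r\<^sup>2 + (x k)\<^sup>2 - 2 * Re z * x k"
        using z2 by (simp add: power2_diff)
      \<comment> \<open>This form permits the bound \<open>1 + u \<le> exp u\<close>, which turns
        the product into a sum in the exponent.\<close>
      also have "\<dots> = (r\<^sup>2 + (x k)\<^sup>2) * (1 + - Re z * (2 * x k / (r\<^sup>2 + (x k)\<^sup>2)))"
        using pos[of "x k"] by (simp add: divide_simps)
      also have "\<dots> \<le> (r\<^sup>2 + (x k)\<^sup>2) * exp (- Re z * (2 * x k / (r\<^sup>2 + (x k)\<^sup>2)))"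
        using pos[of "x k"] by (intro mult_left_mono exp_ge_add_one_self) simp
      finally show "(Re z - x k)\<^sup>2 + (Im z)\<^sup>2 \<le> \<dots>" .
    qed simp
    \<comment> \<open>The exponents add up to a multiple of the sum in \<open>crit\<close>, which is
      0.\<close>
    also have "\<dots> = (\<Prod>k=1..d. r\<^sup>2 + (x k)\<^sup>2) * exp (- Re z * (\<Sum>k=1..d. 2 * x k / (r\<^sup>2 + (x k)\<^sup>2)))"
      by (simp only: prod.distrib exp_sum[OF finite_atLeastAtMost] sum_distrib_left)
    also have "\<dots> = 1"
      by (simp only: crit x(2)) simp
    finally have "(cmod (\<Prod>k=1..d. z - complex_of_real (x k)))\<^sup>2 \<le> 1\<^sup>2"
      by (simp only: power_one)
    then show ?thesis
      by (rule power2_le_imp_le) simp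
  qed
  then have "cball (complex_of_real 0) r
      \<subseteq> lemniscate (map_poly complex_of_real (\<Prod>k=1..d. [:- x k, 1:]))"
    by (auto simp: lemniscate_def poly_of_real_prod_linear simp del: poly_prod)
  moreover have "(\<Prod>k=1..d. [:- x k, 1:]) \<in> K d D"
    using x(1) by (auto simp: K_def)
  ultimately show ?thesis
    using assms(2) unfolding disk_radii_def by blast
qed

text \<open>Every disk radius is dominated by a crossing radius, and the largest crossing radius is
  itself a disk radius, so both sets have the same largest element.\<close>

lemma is_largest_max_radius:
  assumes "d \<ge> 2" "r0 > 0" "r0 \<in> crossing_radii d D"
  shows "is_largest (disk_radii d D) (max_radius d D)"
    and "is_largest (crossing_radii d D) (max_radius d D)"
    and "max_radius d D > 0"
proof -
  obtain r where r: "r \<in> crossing_radii d D" "r > 0" "\<And>s. s \<in> crossing_radii d D \<Longrightarrow> s \<le> r"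
    using crossing_radii_has_max assms by metis
  have d1: "d \<ge> 1" using assms(1) by simp
  have "s \<le> r" if "s \<in> disk_radii d D" for s
    using disk_radius_le_crossing_radius[OF d1 that] r(3) by force
  then have largest: "is_largest (disk_radii d D) r"
    using largest_crossing_radius_disk[OF d1 r(2,1,3)] by (simp add: is_largest_def)
  then have "max_radius d D = r"
    unfolding max_radius_def by (rule the_equality) (use largest in \<open>auto simp: is_largest_def intro: antisym\<close>)
  then show "is_largest (disk_radii d D) (max_radius d D)"
      "is_largest (crossing_radii d D) (max_radius d D)" "max_radius d D > 0"
    using largest r by (auto simp: is_largest_def)
qed

subsection \<open>Products of sines and the discriminant\<close>

text \<open>Both sides are monic of degree \<open>d\<close> and vanish at all \<open>d\<close> roots
  of unity.\<close>

lemma prod_diff_roots_unity: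
  assumes "d > 0"
  shows "(\<Prod>k<d. [:- cis (2 * pi * real k / real d), 1:]) = monom 1 d - 1"
proof (rule poly_eqI_degree_lead_coeff[where A = "{z. z ^ d = 1}" and n = d])
  let ?p = "\<Prod>k<d. [:- cis (2 * pi * real k / real d), 1:]"
  have deg: "degree ?p = d"
    by (subst degree_prod_eq_sum_degree) auto
  have "lead_coeff ?p = 1"
    by (subst lead_coeff_prod) simp
  then show "coeff ?p d = coeff (monom 1 d - 1) d"
    using assms deg by simp
  show "degree ?p \<le> d" using deg by simp
  show "degree (monom 1 d - 1 :: complex poly) \<le> d"
    by (intro degree_diff_le) (auto simp: degree_monom_le)
  show "d \<le> card {z::complex. z ^ d = 1}"
    using assms by (simp add: card_roots_unity_eq)
  fix z :: complex assume z: "z \<in> {z. z ^ d = 1}"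
  then obtain k where "k < d" "z = cis (2 * pi * real k / real d)"
    using Complex.bij_betw_roots_unity[OF assms] unfolding bij_betw_def by blast
  then have "poly ?p z = 0"
    by (auto simp: poly_prod)
  then show "poly ?p z = poly (monom 1 d - 1) z"
    using z by (simp add: poly_monom)
qed

text \<open>The length of a chord of the unit circle; it converts distances between points of the
  circle into sines.\<close>

lemma cmod_one_minus_cis: "cmod (1 - cis (2 * t)) = 2 * \<bar>sin t\<bar>"
proof -
  have "(cmod (1 - cis (2 * t)))\<^sup>2 = (2 * \<bar>sin t\<bar>)\<^sup>2"
    unfolding cmod_power2
    by (simp add: cos_double sin_double power_mult_distrib)
       (use sin_cos_squared_add[of t] in algebra)
  then show ?thesis
    by (rule power2_eq_imp_eq) auto
qed

text \<open>Cancelling X - 1 from X^d - 1 leaves 1 + X + ... + X^(d-1), whose value at 1 is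
  \<open>d\<close>. The remaining linear factors at 1 have chord lengths as moduli.\<close>

lemma prod_sin_pi_div:
  assumes "d > 0"
  shows "(\<Prod>m=1..<d. sin (pi * real m / real d)) = real d / 2 ^ (d - 1)"
proof -
  let ?w = "\<lambda>k. cis (2 * pi * real k / real d)"
  have split: "{..<d} = insert 0 {1..<d}"
    using assms by auto
  have "[:-1, 1:] * (\<Prod>k=1..<d. [:- ?w k, 1:]) = monom 1 d - 1"
    unfolding prod_diff_roots_unity[OF assms, symmetric] split by simp
  also have "\<dots> = [:-1, 1:] * (\<Sum>i<d. monom 1 i)"
    by (rule poly_ext) (simp add: poly_monom poly_sum power_diff_1_eq left_diff_distrib)
  finally have "(\<Prod>k=1..<d. [:- ?w k, 1:]) = (\<Sum>i<d. monom 1 i)"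
    by (simp only: mult_cancel_left) simp
  then have "poly (\<Prod>k=1..<d. [:- ?w k, 1:]) 1 = poly (\<Sum>i<d. monom 1 i) 1"
    by simp
  then have "(\<Prod>k=1..<d. 1 - ?w k) = of_nat d"
    by (simp add: poly_prod poly_sum poly_monom)
  then have "real d = cmod (\<Prod>k=1..<d. 1 - ?w k)"
    by simp
  also have "\<dots> = (\<Prod>k=1..<d. 2 * sin (pi * real k / real d))"
    unfolding prod_norm[symmetric]
  proof (rule prod.cong[OF refl])
    fix k assume k: "k \<in> {1..<d}"
    have "sin (pi * real k / real d) \<ge> 0"
      using k by (intro sin_ge_zero) (auto simp: divide_simps)
    then show "cmod (1 - ?w k) = 2 * sin (pi * real k / real d)"
      using cmod_one_minus_cis[of "pi * real k / real d"] by (simp add: mult.assoc)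
  qed
  finally show ?thesis
    by (simp add: prod.distrib field_simps)
qed

section \<open>Log-concavity of the sine and the extremal property of equally spaced angles\<close>

text \<open>The concave function \<open>ln \<circ> sin\<close> lies below its tangent at
  \<open>b\<close>, whose slope is \<open>cot b\<close>; the inequality is then
  exponentiated.\<close>

lemma sin_le_tangent:
  assumes "0 < a" "a < pi" "0 < b" "b < pi"
  shows "sin a \<le> sin b * exp (cot b * (a - b))"
proof -
  have "convex_on {0<..<pi} (\<lambda>x. - ln (sin x))"
  proof (rule f''_ge0_imp_convex)
    fix x :: real assume "x \<in> {0<..<pi}"
    then have s: "sin x > 0" by (simp add: sin_gt_zero)
    show "((\<lambda>x. - ln (sin x)) has_real_derivative - cot x) (at x)"
      using s by (auto intro!: derivative_eq_intros simp: cot_def)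
    show "((\<lambda>x. - cot x) has_real_derivative inverse ((sin x)\<^sup>2)) (at x)"
      using s DERIV_minus[OF DERIV_cot[of x]] by simp
  qed auto
  then have "- ln (sin a) - (- ln (sin b)) \<ge> - cot b * (a - b)"
  proof (rule convex_on_imp_above_tangent)
    have "sin b > 0" using assms by (simp add: sin_gt_zero)
    then have "((\<lambda>x. - ln (sin x)) has_real_derivative - cot b) (at b)"
      by (auto intro!: derivative_eq_intros simp: cot_def)
    then show "((\<lambda>x. - ln (sin x)) has_real_derivative - cot b) (at b within {0<..<pi})"
      by (rule has_field_derivative_at_within)
  qed (use assms in auto)
  then have "ln (sin a) \<le> ln (sin b) + cot b * (a - b)" by simp
  then have "exp (ln (sin a)) \<le> exp (ln (sin b) + cot b * (a - b))" by simp
  then show ?thesis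
    using assms by (simp add: exp_add sin_gt_zero)
qed

text \<open>Jensen's inequality in product form: in the product of the tangent bounds at the mean
  \<open>b\<close> the exponents cancel.\<close>

lemma prod_sin_le_sin_mean:
  assumes "finite J" "\<And>j. j \<in> J \<Longrightarrow> 0 < u j \<and> u j < pi" "0 < b" "b < pi" "(\<Sum>j\<in>J. u j) = real (card J) * b"
  shows "(\<Prod>j\<in>J. sin (u j)) \<le> sin b ^ card J"
proof -
  have "(\<Prod>j\<in>J. sin (u j)) \<le> (\<Prod>j\<in>J. sin b * exp (cot b * (u j - b)))"
    using assms(2-4) by (intro prod_mono conjI sin_le_tangent sin_ge_zero) (auto intro: less_imp_le)
  also have "\<dots> = sin b ^ card J * exp (cot b * (\<Sum>j\<in>J. u j - b))"
    using assms(1) by (simp add: prod.distrib exp_sum sum_distrib_left)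
  also have "(\<Sum>j\<in>J. u j - b) = 0"
    using assms(5) by (simp add: sum_subtractf)
  finally show ?thesis by simp
qed

lemma prod_pairs_reindex:
  assumes "bij_betw h A B"
  shows "(\<Prod>a\<in>A. \<Prod>a'\<in>A - {a}. g (h a) (h a')) = (\<Prod>b\<in>B. \<Prod>b'\<in>B - {b}. g b b')"
proof -
  have "(\<Prod>a'\<in>A - {a}. g (h a) (h a')) = (\<Prod>b'\<in>B - {h a}. g (h a) b')" if "a \<in> A" for a
    using that assms
    by (intro prod.reindex_bij_betw bij_betw_DiffI) (auto simp: bij_betw_def)
  then show ?thesis
    using prod.reindex_bij_betw[OF assms, of "\<lambda>b. \<Prod>b'\<in>B - {b}. g b b'"] by simp
qed

lemma abs_sin_add_int_pi: "\<bar>sin (x + pi * real n)\<bar> = \<bar>sin x\<bar>"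
  by (simp add: sin_add abs_mult mult.commute[of pi])

lemma quasiperiodic_iterate:
  fixes u :: "nat \<Rightarrow> real"
  assumes "\<And>n. u (n + d) = u n + pi"
  shows "u (n + d * q) = u n + pi * real q"
  by (induction q) (use assms[of "n + d * _"] in \<open>auto simp: algebra_simps\<close>)

text \<open>The ordered pairs are grouped by their cyclic step \<open>m\<close>. Wrapping past
  \<open>d\<close> changes \<open>u\<close> by a multiple of \<open>pi\<close>, which
  \<open>\<bar>sin\<bar>\<close> does not see.\<close>

lemma prod_pairs_sin_cyclic:
  fixes u :: "nat \<Rightarrow> real"
  assumes "\<And>n. u (n + d) = u n + pi"
  shows "(\<Prod>j<d. \<Prod>k\<in>{..<d} - {j}. \<bar>sin (u j - u k)\<bar>)
    = (\<Prod>m=1..<d. \<Prod>j<d. \<bar>sin (u (j + m) - u j)\<bar>)"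
proof -
  have "(\<Prod>k\<in>{..<d} - {j}. \<bar>sin (u j - u k)\<bar>) = (\<Prod>m=1..<d. \<bar>sin (u (j + m) - u j)\<bar>)"
    if j: "j < d" for j
  proof -
    \<comment> \<open>In the inverse map, adding \<open>d\<close> first keeps the subtraction of
      \<open>j\<close> from truncating.\<close>
    have "bij_betw (\<lambda>m. (j + m) mod d) {1..<d} ({..<d} - {j})"
    proof (rule bij_betw_byWitness[where f' = "\<lambda>k. (k + d - j) mod d"])
      show "\<forall>m\<in>{1..<d}. ((j + m) mod d + d - j) mod d = m"
        using j by (auto simp: mod_if)
      show "\<forall>k\<in>{..<d} - {j}. (j + (k + d - j) mod d) mod d = k"
        using j by (auto simp: mod_if)
      show "(\<lambda>m. (j + m) mod d) ` {1..<d} \<subseteq> {..<d} - {j}"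
        using j by (auto simp: mod_if)
      show "(\<lambda>k. (k + d - j) mod d) ` ({..<d} - {j}) \<subseteq> {1..<d}"
        using j by (auto simp: mod_if)
    qed
    then have "(\<Prod>k\<in>{..<d} - {j}. \<bar>sin (u j - u k)\<bar>) = (\<Prod>m=1..<d. \<bar>sin (u j - u ((j + m) mod d))\<bar>)"
      by (rule prod.reindex_bij_betw[symmetric])
    also have "\<dots> = (\<Prod>m=1..<d. \<bar>sin (u (j + m) - u j)\<bar>)"
    proof (rule prod.cong[OF refl])
      fix m
      have "u (j + m) = u ((j + m) mod d) + pi * real ((j + m) div d)"
        using quasiperiodic_iterate[of u d, OF assms, of "(j + m) mod d" "(j + m) div d"] by simp
      then have "\<bar>sin (u (j + m) - u j)\<bar> = \<bar>sin (u ((j + m) mod d) - u j)\<bar>"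
        using abs_sin_add_int_pi[of "u ((j + m) mod d) - u j" "(j + m) div d"]
        by (simp add: algebra_simps)
      also have "\<dots> = \<bar>sin (u j - u ((j + m) mod d))\<bar>"
        by (metis abs_minus_cancel minus_diff_eq sin_minus)
      finally show "\<bar>sin (u j - u ((j + m) mod d))\<bar> = \<bar>sin (u (j + m) - u j)\<bar>" by simp
    qed
    finally show ?thesis .
  qed
  then have "(\<Prod>j<d. \<Prod>k\<in>{..<d} - {j}. \<bar>sin (u j - u k)\<bar>)
      = (\<Prod>j<d. \<Prod>m=1..<d. \<bar>sin (u (j + m) - u j)\<bar>)"
    by simp
  then show ?thesis
    by (simp add: prod.swap[of _ "{..<d}"])
qed

text \<open>The equality case of the bound on products of sines: all \<open>d\<close> gaps of step
  \<open>m\<close> equal \<open>pi * real m / real d\<close>.\<close>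

lemma prod_pairs_sin_equispaced:
  assumes "d > 0"
  shows "(\<Prod>j<d. \<Prod>k\<in>{..<d} - {j}. \<bar>sin ((a + pi * real j / real d) - (a + pi * real k / real d))\<bar>)
    = (real d / 2 ^ (d - 1)) ^ d"
proof -
  let ?u = "\<lambda>n. a + pi * real n / real d"
  have "(\<Prod>j<d. \<Prod>k\<in>{..<d} - {j}. \<bar>sin (?u j - ?u k)\<bar>)
      = (\<Prod>m=1..<d. \<Prod>j<d. \<bar>sin (?u (j + m) - ?u j)\<bar>)"
    by (rule prod_pairs_sin_cyclic) (use assms in \<open>simp add: field_simps\<close>)
  also have "\<dots> = (\<Prod>m=1..<d. sin (pi * real m / real d) ^ d)"
  proof (rule prod.cong[OF refl])
    fix m assume m: "m \<in> {1..<d}"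
    then have "sin (pi * real m / real d) \<ge> 0"
      by (intro sin_ge_zero) (auto simp: divide_simps)
    moreover have "?u (j + m) - ?u j = pi * real m / real d" for j
      by (simp add: distrib_left add_divide_distrib)
    ultimately show "(\<Prod>j<d. \<bar>sin (?u (j + m) - ?u j)\<bar>) = sin (pi * real m / real d) ^ d"
      by simp
  qed
  also have "\<dots> = (real d / 2 ^ (d - 1)) ^ d"
    by (simp only: prod_sin_pi_div[OF assms] flip: prod_power_distrib)
  finally show ?thesis .
qed

text \<open>For each step \<open>m\<close> the \<open>d\<close> gaps lie strictly between 0 and
  \<open>pi\<close> and sum to \<open>pi * real m\<close>. Jensen's inequality therefore bounds
  their product of sines by the one for equal gaps.\<close>

lemma prod_pairs_sin_le:
  fixes t :: "nat \<Rightarrow> real"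
  assumes "d > 0" and mono: "\<And>i j. i < j \<Longrightarrow> j < d \<Longrightarrow> t i < t j \<and> t j < t i + pi"
  shows "(\<Prod>j<d. \<Prod>k\<in>{..<d} - {j}. \<bar>sin (t j - t k)\<bar>) \<le> (real d / 2 ^ (d - 1)) ^ d"
proof -
  \<comment> \<open>The quasiperiodic extension of \<open>t\<close>: the same angles modulo
    \<open>pi\<close>, continued in increasing order.\<close>
  define u where "u = (\<lambda>n. t (n mod d) + pi * real (n div d))"
  have u_add: "u (n + d) = u n + pi" for n
    using assms(1) by (simp add: u_def algebra_simps)
  \<comment> \<open>Moving the window of length \<open>d\<close> by one replaces \<open>u m\<close>
    by \<open>u (m + d) = u m + pi\<close>.\<close>
  have u_shift: "(\<Sum>j<d. u (j + m)) = (\<Sum>j<d. u j) + pi * real m" for m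
  proof (induction m)
    case (Suc m)
    have "u m + (\<Sum>j<d. u (j + Suc m)) = (\<Sum>j<Suc d. u (j + m))"
      unfolding sum.lessThan_Suc_shift by simp
    also have "\<dots> = (\<Sum>j<d. u (j + m)) + (u m + pi)"
      using u_add[of m] by (simp add: add.commute)
    finally show ?case using Suc by (simp add: algebra_simps)
  qed simp
  have gap: "0 < u (j + m) - u j \<and> u (j + m) - u j < pi" if "j < d" "m \<in> {1..<d}" for j m
  proof (cases "j + m < d")
    case True
    then show ?thesis using mono[of j "j + m"] that by (simp add: u_def)
  next
    case False
    \<comment> \<open>After wrapping, the gap is \<open>pi - (t j - t (j + m - d))\<close>, with
      indices \<open>j + m - d < j\<close>.\<close>
    then have "(j + m) mod d = j + m - d" "(j + m) div d = 1"
      using that by (auto simp: mod_if div_if)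
    then show ?thesis using mono[of "j + m - d" j] that False by (simp add: u_def)
  qed
  have "(\<Prod>j<d. \<Prod>k\<in>{..<d} - {j}. \<bar>sin (t j - t k)\<bar>) = (\<Prod>j<d. \<Prod>k\<in>{..<d} - {j}. \<bar>sin (u j - u k)\<bar>)"
    by (intro prod.cong refl) (auto simp: u_def)
  also have "\<dots> = (\<Prod>m=1..<d. \<Prod>j<d. \<bar>sin (u (j + m) - u j)\<bar>)"
    using u_add by (rule prod_pairs_sin_cyclic)
  also have "\<dots> = (\<Prod>m=1..<d. \<Prod>j<d. sin (u (j + m) - u j))"
    using gap by (intro prod.cong refl abs_of_nonneg sin_ge_zero) (auto intro: less_imp_le)
  also have "\<dots> \<le> (\<Prod>m=1..<d. sin (pi * real m / real d) ^ d)"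
  proof (rule prod_mono, intro conjI)
    fix m assume m: "m \<in> {1..<d}"
    show "0 \<le> (\<Prod>j<d. sin (u (j + m) - u j))"
      using gap m by (intro prod_nonneg sin_ge_zero) (auto intro: less_imp_le)
    have "(\<Prod>j<d. sin (u (j + m) - u j)) \<le> sin (pi * real m / real d) ^ card {..<d}"
    proof (rule prod_sin_le_sin_mean)
      show "0 < u (j + m) - u j \<and> u (j + m) - u j < pi" if "j \<in> {..<d}" for j
        using gap that m by auto
      show "(\<Sum>j<d. u (j + m) - u j) = real (card {..<d}) * (pi * real m / real d)"
        using assms(1) by (simp add: sum_subtractf u_shift)
    qed (use m in \<open>auto simp: divide_simps\<close>)
    then show "(\<Prod>j<d. sin (u (j + m) - u j)) \<le> sin (pi * real m / real d) ^ d" by simp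
  qed
  also have "\<dots> = (real d / 2 ^ (d - 1)) ^ d"
    by (simp only: prod_sin_pi_div[OF assms(1)] flip: prod_power_distrib)
  finally show ?thesis .
qed

lemma prod_pairs_sin_set_le:
  fixes S :: "real set"
  assumes "finite S" "S \<noteq> {}" and diam: "\<And>a b. a \<in> S \<Longrightarrow> b \<in> S \<Longrightarrow> b < a + pi"
  shows "(\<Prod>a\<in>S. \<Prod>b\<in>S - {a}. \<bar>sin (a - b)\<bar>) \<le> (real (card S) / 2 ^ (card S - 1)) ^ card S"
proof -
  let ?L = "sorted_list_of_set S"
  have len: "length ?L = card S" by simp
  have "bij_betw ((!) ?L) {..<card S} S"
    using bij_betw_nth[of ?L "{..<card S}" S] assms(1) by simp
  then have "(\<Prod>a\<in>S. \<Prod>b\<in>S - {a}. \<bar>sin (a - b)\<bar>)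
      = (\<Prod>j<card S. \<Prod>k\<in>{..<card S} - {j}. \<bar>sin (?L ! j - ?L ! k)\<bar>)"
    by (rule prod_pairs_reindex[symmetric])
  also have "\<dots> \<le> (real (card S) / 2 ^ (card S - 1)) ^ card S"
  proof (rule prod_pairs_sin_le)
    show "card S > 0" using assms by (simp add: card_gt_0_iff)
    fix i j assume ij: "i < j" "j < card S"
    then have "?L ! i \<in> S" "?L ! j \<in> S"
      using assms(1) by (metis len less_trans nth_mem set_sorted_list_of_set)+
    moreover have "?L ! i < ?L ! j"
      using ij len strict_sorted_list_of_set[of S] sorted_wrt_nth_less by metis
    ultimately show "?L ! i < ?L ! j \<and> ?L ! j < ?L ! i + pi"
      using diam by blast
  qed
  finally show ?thesis .
qed

section \<open>The discriminant in tangent coordinates and the resulting upper bound\<close>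

text \<open>The identity tan a - tan b = sin(a - b) / (cos a cos b), multiplied over all ordered
  pairs; each cosine enters \<open>2 * (d - 1)\<close> times.\<close>

lemma discr_tan:
  assumes "r \<ge> 0" and cos_pos: "\<And>k. k \<in> {1..d} \<Longrightarrow> cos (t k) > 0"
  shows "discr d (\<lambda>k. r * tan (t k)) * (\<Prod>k=1..d. cos (t k)) ^ (2 * (d - 1))
    = r ^ (d * (d - 1)) * (\<Prod>j=1..d. \<Prod>k\<in>{1..d} - {j}. \<bar>sin (t j - t k)\<bar>)"
proof -
  let ?C = "\<Prod>k=1..d. cos (t k)"
  have C: "(\<Prod>k\<in>{1..d} - {j}. cos (t j) * cos (t k)) = cos (t j) ^ (d - 1) * (\<Prod>k\<in>{1..d} - {j}. cos (t k))"
    if "j \<in> {1..d}" for j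
    using that by (simp add: prod.distrib)
  \<comment> \<open>The extra factor \<open>?C\<close> supplies, for each \<open>j\<close>, the
    cosine missing at \<open>k = j\<close>.\<close>
  have "(\<Prod>j=1..d. \<Prod>k\<in>{1..d} - {j}. cos (t j) * cos (t k)) * ?C
      = (\<Prod>j=1..d. cos (t j) ^ (d - 1) * (cos (t j) * (\<Prod>k\<in>{1..d} - {j}. cos (t k))))"
    unfolding prod.distrib[symmetric] by (intro prod.cong refl) (simp only: C mult_ac)
  also have "\<dots> = (\<Prod>j=1..d. cos (t j) ^ (d - 1) * ?C)"
    by (intro prod.cong refl) (simp only: prod.remove[OF finite_atLeastAtMost, of _ 1 d "\<lambda>k. cos (t k)"])
  also have "\<dots> = ?C ^ (d - 1) * ?C ^ d"
    by (simp add: prod.distrib prod_power_distrib)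
  finally have "(\<Prod>j=1..d. \<Prod>k\<in>{1..d} - {j}. cos (t j) * cos (t k)) * ?C = ?C ^ (d - 1) * ?C ^ d" .
  moreover have "?C > 0"
    by (rule prod_pos) (use cos_pos in auto)
  \<comment> \<open>Cancels one factor \<open>c\<close>; for \<open>d = 0\<close>, where
    \<open>d - 1\<close> truncates, the empty product gives \<open>c = 1\<close>.\<close>
  moreover have "c ^ (2 * (d - 1)) = p" if "p * c = c ^ (d - 1) * c ^ d" "c > 0" "d = 0 \<longrightarrow> c = 1" for p c :: real
    using that by (cases d) (auto simp: mult_2 power_add)
  ultimately have cosines: "?C ^ (2 * (d - 1)) = (\<Prod>j=1..d. \<Prod>k\<in>{1..d} - {j}. cos (t j) * cos (t k))"
    by simp
  have "\<bar>tan (t j) - tan (t k)\<bar> * (cos (t j) * cos (t k)) = \<bar>sin (t j - t k)\<bar>"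
    if "j \<in> {1..d}" "k \<in> {1..d}" for j k
  proof -
    have pos: "cos (t j) > 0" "cos (t k) > 0" using cos_pos that by auto
    then have "\<bar>tan (t j) - tan (t k)\<bar> * (cos (t j) * cos (t k))
        = \<bar>(tan (t j) - tan (t k)) * (cos (t j) * cos (t k))\<bar>"
      by (simp add: abs_mult)
    also have "(tan (t j) - tan (t k)) * (cos (t j) * cos (t k)) = sin (t j - t k)"
      using pos by (simp add: tan_def sin_diff field_simps)
    finally show ?thesis .
  qed
  then have "(\<Prod>j=1..d. \<Prod>k\<in>{1..d} - {j}. \<bar>tan (t j) - tan (t k)\<bar>) * ?C ^ (2 * (d - 1))
      = (\<Prod>j=1..d. \<Prod>k\<in>{1..d} - {j}. \<bar>sin (t j - t k)\<bar>)"
    unfolding cosines prod.distrib[symmetric] by (intro prod.cong refl) auto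
  then show ?thesis
    unfolding discr_scale by (simp add: discr_eq_prod_pairs mult.assoc)
qed

text \<open>Rests on 1 + tan^2 = 1/cos^2. For \<open>r > 0\<close>, the crossing condition thus says
  that the product of the cosines is \<open>r ^ d\<close>.\<close>

lemma prod_sq_tan:
  fixes t :: "nat \<Rightarrow> real"
  assumes "\<And>k. k \<in> {1..d} \<Longrightarrow> cos (t k) > 0"
  shows "(\<Prod>k=1..d. r\<^sup>2 + (r * tan (t k))\<^sup>2) * (\<Prod>k=1..d. cos (t k))\<^sup>2 = (r ^ d)\<^sup>2"
proof -
  have "(\<Prod>k=1..d. r\<^sup>2 + (r * tan (t k))\<^sup>2) * (\<Prod>k=1..d. cos (t k))\<^sup>2
      = (\<Prod>k=1..d. (r\<^sup>2 + (r * tan (t k))\<^sup>2) * (cos (t k))\<^sup>2)"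
    by (simp add: prod.distrib prod_power_distrib)
  also have "\<dots> = (\<Prod>k=1..d. r\<^sup>2)"
  proof (rule prod.cong[OF refl])
    fix k assume "k \<in> {1..d}"
    then have "cos (t k) \<noteq> 0" using assms by force
    then have "sin (t k) = tan (t k) * cos (t k)" by (simp add: tan_def)
    then have "(r\<^sup>2 + (r * tan (t k))\<^sup>2) * (cos (t k))\<^sup>2 = r\<^sup>2 * ((cos (t k))\<^sup>2 + (sin (t k))\<^sup>2)"
      by (simp add: algebra_simps power2_eq_square)
    then show "(r\<^sup>2 + (r * tan (t k))\<^sup>2) * (cos (t k))\<^sup>2 = r\<^sup>2" by simp
  qed
  finally show ?thesis
    by (simp add: power_mult[symmetric] mult.commute)
qed

text \<open>At a crossing radius the product of the cosines is determined by \<open>r\<close>, so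
  \<open>D * r ^ (d * (d - 1))\<close> is exactly the product of the sines, to which the extremal
  bound applies.\<close>

lemma discr_crossing_bound:
  assumes "d \<ge> 2" "D > 0" "r > 0" "r \<in> crossing_radii d D"
  shows "D * (2 * r) ^ (d * (d - 1)) \<le> real d ^ d"
proof -
  obtain x where x: "discr d x = D" "(\<Prod>k=1..d. r\<^sup>2 + (x k)\<^sup>2) = 1"
    using assms(4) by (auto simp: crossing_radii_def)
  define t where "t = (\<lambda>k. arctan (x k / r))"
  have xt: "x = (\<lambda>k. r * tan (t k))"
    using assms(3) by (auto simp: t_def tan_arctan)
  have cos_pos: "cos (t k) > 0" for k
    unfolding t_def by (rule cos_gt_zero_pi) (use arctan_bounded in auto)
  let ?C = "\<Prod>k=1..d. cos (t k)"
  let ?A = "\<Prod>j=1..d. \<Prod>k\<in>{1..d} - {j}. \<bar>sin (t j - t k)\<bar>"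
  have C2: "?C\<^sup>2 = (r ^ d)\<^sup>2"
    using prod_sq_tan[of d t r] cos_pos x(2) by (simp add: xt)
  have "D * ?C ^ (2 * (d - 1)) = r ^ (d * (d - 1)) * ?A"
    using discr_tan[of r d t] cos_pos assms(3) x(1) by (simp add: xt)
  moreover have "?C ^ (2 * (d - 1)) = r ^ (d * (d - 1)) * r ^ (d * (d - 1))"
    unfolding power_mult C2 by (simp add: power_mult_distrib ac_simps flip: power_mult power_add mult_2)
  ultimately have A: "D * r ^ (d * (d - 1)) = ?A"
    using assms(3) by simp
  moreover have "D * r ^ (d * (d - 1)) > 0" using assms(2,3) by simp
  \<comment> \<open>A nonzero product makes the angles distinct, so passing to their set loses no
    multiplicity.\<close>
  ultimately have "?A \<noteq> 0" by linarith
  then have "sin (t j - t k) \<noteq> 0" if "j \<in> {1..d}" "k \<in> {1..d} - {j}" for j k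
    using that by (auto simp: prod_zero_iff)
  then have inj: "inj_on t {1..d}"
    by (intro inj_onI) (metis DiffI diff_self singletonD sin_zero)
  have "?A = (\<Prod>a\<in>t ` {1..d}. \<Prod>b\<in>t ` {1..d} - {a}. \<bar>sin (a - b)\<bar>)"
    by (rule prod_pairs_reindex) (use inj in \<open>auto simp: bij_betw_def\<close>)
  also have "\<dots> \<le> (real (card (t ` {1..d})) / 2 ^ (card (t ` {1..d}) - 1)) ^ card (t ` {1..d})"
  proof (rule prod_pairs_sin_set_le)
    fix a b assume "a \<in> t ` {1..d}" "b \<in> t ` {1..d}"
    then obtain j k where "a = t j" "b = t k" by blast
    then show "b < a + pi"
      using arctan_lbound[of "x j / r"] arctan_ubound[of "x k / r"] unfolding t_def by linarith
  qed (use assms(1) in auto)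
  also have "\<dots> = real d ^ d / 2 ^ (d * (d - 1))"
    using inj by (simp add: card_image power_divide mult.commute flip: power_mult)
  finally have "D * r ^ (d * (d - 1)) * 2 ^ (d * (d - 1)) \<le> real d ^ d"
    using A by (simp add: field_simps)
  then show ?thesis
    by (simp add: power_mult_distrib mult_ac)
qed

section \<open>Root configurations from rotated equally spaced angles\<close>

text \<open>Evaluates X^d - 1 at a point of the unit circle and reads all factors as chords. For
  \<open>f = 0\<close> the angles lie symmetrically about 0; \<open>f\<close> is the
  rotation.\<close>

lemma prod_cos_equispaced:
  assumes "d > 0"
  shows "(\<Prod>k<d. 2 * \<bar>cos (f + (pi / 2) / real d - pi / 2 + pi * real k / real d)\<bar>) = 2 * \<bar>cos (real d * f)\<bar>"
proof -
  let ?w = "\<lambda>k. cis (2 * pi * real k / real d)"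
  \<comment> \<open>Chosen so that the chord from \<open>?z\<close> to \<open>?w k\<close> has
    half-angle \<open>?s\<close>, which exceeds the angle in the cosine by
    \<open>pi / 2\<close>.\<close>
  let ?z = "cis (- (pi / real d + 2 * f))"
  have z_pow: "?z ^ d = cis (- (pi + 2 * (real d * f)))"
  proof -
    have "real d * - (pi / real d + 2 * f) = - (pi + 2 * (real d * f))"
      using assms by (simp add: field_simps)
    then show ?thesis by (simp only: Complex.DeMoivre)
  qed
  have "cmod (?z - ?w k) = 2 * \<bar>cos (f + (pi / 2) / real d - pi / 2 + pi * real k / real d)\<bar>" for k
  proof -
    let ?s = "f + (pi / 2) / real d + pi * real k / real d"
    have "?z - ?w k = ?z * (1 - cis (2 * ?s))"
      by (simp add: right_diff_distrib cis_mult) (simp add: algebra_simps)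
    then have "cmod (?z - ?w k) = 2 * \<bar>sin ?s\<bar>"
      by (simp only: norm_mult norm_cis mult_1_left cmod_one_minus_cis)
    also have "sin ?s = cos (?s - pi / 2)"
      by (simp add: cos_diff)
    finally show ?thesis by (simp add: algebra_simps)
  qed
  then have "(\<Prod>k<d. 2 * \<bar>cos (f + (pi / 2) / real d - pi / 2 + pi * real k / real d)\<bar>)
      = cmod (\<Prod>k<d. ?z - ?w k)"
    by (simp flip: prod_norm)
  also have "(\<Prod>k<d. ?z - ?w k) = poly (\<Prod>k<d. [:- ?w k, 1:]) ?z"
    by (simp add: poly_prod)
  also have "\<dots> = cis (- (pi + 2 * (real d * f))) - 1"
    unfolding prod_diff_roots_unity[OF assms]
    by (simp only: poly_diff poly_1 poly_monom z_pow mult_1_left)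
  also have "cmod \<dots> = cmod (1 - cis (2 * (- pi / 2 - real d * f)))"
    by (subst norm_minus_commute) (simp add: algebra_simps)
  also have "\<dots> = 2 * \<bar>cos (real d * f)\<bar>"
    unfolding cmod_one_minus_cis by (simp add: sin_diff)
  finally show ?thesis .
qed

text \<open>Here \<open>c\<close> is the prescribed product of the cosines:
  \<open>2 ^ (d - 1) * c \<le> 1\<close> makes it attainable by a rotation,
  \<open>s ^ d \<le> c\<close> keeps the product at \<open>s\<close> at most 1, and the last
  hypothesis makes the discriminant equal to \<open>D\<close>.\<close>

lemma ex_crossing_radius_equispaced:
  assumes "d \<ge> 2" "s > 0" "c > 0" "2 ^ (d - 1) * c \<le> 1" "s ^ d \<le> c"
    and D: "D * c ^ (2 * (d - 1)) = s ^ (d * (d - 1)) * (real d / 2 ^ (d - 1)) ^ d"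
  shows "\<exists>r \<in> crossing_radii d D. r \<ge> s"
proof -
  have d0: "d > 0" using assms(1) by simp
  \<comment> \<open>Solves \<open>2 * cos (real d * f) = 2 ^ d * c\<close>, the value of the product
    of the doubled cosines.\<close>
  define f where "f = arccos (2 ^ (d - 1) * c) / real d"
  have df: "0 \<le> real d * f" "real d * f < pi / 2" "cos (real d * f) = 2 ^ (d - 1) * c"
    using assms(3,4) d0 less_le_trans[of "-1" 0 "2 ^ (d - 1) * c"] arccos_less_arccos[of 0 "2 ^ (d - 1) * c"]
    by (auto simp: f_def cos_arccos intro!: arccos_lbound)
  \<comment> \<open>The shift \<open>k - 1\<close> is due to roots being indexed from 1.\<close>
  define t where "t = (\<lambda>k. f + (pi / 2) / real d - pi / 2 + pi * real (k - 1) / real d)"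
  have cos_pos: "cos (t k) > 0" if "k \<in> {1..d}" for k
  proof (rule cos_gt_zero_pi)
    have "f \<ge> 0" using df(1) d0 by (simp add: zero_le_mult_iff)
    moreover have "(pi / 2) / real d > 0" "pi * real (k - 1) / real d \<ge> 0"
      using d0 by auto
    ultimately show "- (pi / 2) < t k"
      unfolding t_def by linarith
    \<comment> \<open>The largest angle, at \<open>k = d\<close>, is
      \<open>pi / 2 - pi / (2 * real d) + f\<close>, which is below \<open>pi / 2\<close> since
      \<open>real d * f < pi / 2\<close>.\<close>
    have "pi * real (k - 1) \<le> pi * (real d - 1)"
      using that by (intro mult_left_mono) auto
    moreover have "real d * t k = real d * f + pi / 2 - real d * (pi / 2) + pi * real (k - 1)"
      using d0 by (simp add: t_def distrib_left right_diff_distrib)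
    ultimately have "real d * t k < real d * (pi / 2)"
      using df(2) by (simp add: right_diff_distrib mult.commute[of pi])
    then show "t k < pi / 2"
      using d0 by simp
  qed
  have shift: "bij_betw Suc {..<d} {1..d}"
    by (rule bij_betw_byWitness[where f' = "\<lambda>k. k - 1"]) auto
  have "2 ^ d * (\<Prod>k=1..d. cos (t k)) = (\<Prod>k=1..d. 2 * \<bar>cos (t k)\<bar>)"
    using cos_pos by (simp add: prod.distrib abs_of_pos del: One_nat_def)
  also have "\<dots> = (\<Prod>k<d. 2 * \<bar>cos (t (Suc k))\<bar>)"
    by (rule prod.reindex_bij_betw[OF shift, symmetric])
  also have "\<dots> = 2 * \<bar>cos (real d * f)\<bar>"
    using prod_cos_equispaced[OF d0, of f] by (simp add: t_def)
  also have "\<dots> = 2 ^ d * c"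
    using df(3) assms(3) power_minus_mult[OF d0, of "2::real"] by (simp add: abs_of_pos mult.commute mult.left_commute)
  finally have C: "(\<Prod>k=1..d. cos (t k)) = c" by simp
  have "(\<Prod>j=1..d. \<Prod>k\<in>{1..d} - {j}. \<bar>sin (t j - t k)\<bar>)
      = (\<Prod>j<d. \<Prod>k\<in>{..<d} - {j}. \<bar>sin (t (Suc j) - t (Suc k))\<bar>)"
    by (rule prod_pairs_reindex[OF shift, symmetric])
  also have "\<dots> = (real d / 2 ^ (d - 1)) ^ d"
    using prod_pairs_sin_equispaced[OF d0, of "f + (pi / 2) / real d - pi / 2"] by (simp add: t_def)
  finally have "discr d (\<lambda>k. s * tan (t k)) * c ^ (2 * (d - 1))
      = s ^ (d * (d - 1)) * (real d / 2 ^ (d - 1)) ^ d"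
    using discr_tan[of s d t] assms(2) cos_pos C by simp
  then have "discr d (\<lambda>k. s * tan (t k)) * c ^ (2 * (d - 1)) = D * c ^ (2 * (d - 1))"
    using D by simp
  then have discr: "discr d (\<lambda>k. s * tan (t k)) = D"
    using assms(3) by simp
  have "(\<Prod>k=1..d. s\<^sup>2 + (s * tan (t k))\<^sup>2) * c\<^sup>2 = (s ^ d)\<^sup>2"
    using prod_sq_tan[of d t s] cos_pos C by simp
  also have "\<dots> \<le> 1 * c\<^sup>2"
    using assms(2,5) by (simp add: power_mono)
  finally have "(\<Prod>k=1..d. s\<^sup>2 + (s * tan (t k))\<^sup>2) \<le> 1"
    using assms(3) by (simp only: mult_le_cancel_right) simp
  then show ?thesis
    using ex_crossing_radius_ge[of d s "\<lambda>k. s * tan (t k)" D] discr assms by simp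
qed

subsection \<open>Bounds for the largest radius\<close>

text \<open>The \<beta> of the introduction: for \<open>d \<ge> 2\<close> and \<open>D > 0\<close>,
  the positive \<open>r\<close> at which \<open>discr_crossing_bound\<close> becomes an
  equality.\<close>

definition radius_bound :: "nat \<Rightarrow> real \<Rightarrow> real" where
  "radius_bound d D = real d powr (1 / (real d - 1)) / (2 * D powr (1 / (real d * (real d - 1))))"

lemma radius_bound_pos: "d \<ge> 2 \<Longrightarrow> D > 0 \<Longrightarrow> radius_bound d D > 0"
  by (simp add: radius_bound_def)

lemma radius_bound_power:
  assumes "d \<ge> 2" "D > 0"
  shows "D * (2 * radius_bound d D) ^ (d * (d - 1)) = real d ^ d"
proof -
  have N: "real (d * (d - 1)) = real d * (real d - 1)"
    using assms(1) by (simp add: of_nat_diff)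
  have nz: "real d - 1 \<noteq> 0" "real d \<noteq> 0" using assms(1) by auto
  have "(real d powr (1 / (real d - 1))) ^ (d * (d - 1)) = real d powr (real d)"
    using nz by (simp add: powr_powr N flip: powr_realpow')
  moreover have "(D powr (1 / (real d * (real d - 1)))) ^ (d * (d - 1)) = D"
    using nz assms(2) by (simp add: powr_powr N flip: powr_realpow')
  ultimately show ?thesis
    using assms by (simp add: radius_bound_def power_divide powr_realpow)
qed

lemma crossing_radius_le_bound:
  assumes "d \<ge> 2" "D > 0" "r > 0" "r \<in> crossing_radii d D"
  shows "r \<le> radius_bound d D"
proof -
  have "D * (2 * r) ^ (d * (d - 1)) \<le> D * (2 * radius_bound d D) ^ (d * (d - 1))"
    using discr_crossing_bound[OF assms] radius_bound_power[OF assms(1,2)] by simp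
  then have "(2 * r) ^ (d * (d - 1)) \<le> (2 * radius_bound d D) ^ (d * (d - 1))"
    using assms(2) by simp
  then have "2 * r \<le> 2 * radius_bound d D"
    using assms radius_bound_pos[OF assms(1,2)] by (subst (asm) power_mono_iff) auto
  then show ?thesis by simp
qed

text \<open>The two upper bounds on \<open>s\<close> are the conditions \<open>s ^ d \<le> c\<close>
  and \<open>2 ^ (d - 1) * c \<le> 1\<close> of the equally spaced construction, rewritten for the
  \<open>c\<close> that the discriminant dictates.\<close>

lemma ex_crossing_radius_of_bound:
  assumes "d \<ge> 2" "D > 0" "s > 0" "s \<le> radius_bound d D" "s * radius_bound d D \<le> 4 powr (1 / real d - 1)"
  shows "\<exists>r \<in> crossing_radii d D. r \<ge> s"
proof -
  let ?b = "radius_bound d D"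
  \<comment> \<open>Inserting \<open>radius_bound_power\<close> into the discriminant equation
    forces \<open>c\<^sup>2 = (s * ?b) ^ d\<close>.\<close>
  define c where "c = sqrt ((s * ?b) ^ d)"
  have b: "?b > 0" by (rule radius_bound_pos[OF assms(1,2)])
  have c: "c > 0" "c\<^sup>2 = (s * ?b) ^ d"
    using b assms(3) by (auto simp: c_def)
  show ?thesis
  proof (rule ex_crossing_radius_equispaced[OF assms(1,3) c(1)])
    have "(2 ^ (d - 1) * c)\<^sup>2 = 4 ^ (d - 1) * (s * ?b) ^ d"
      by (simp add: power_mult_distrib c(2) power_commutes flip: power_mult) (simp add: power_mult mult.commute)
    also have "\<dots> \<le> 4 ^ (d - 1) * (4 powr (1 / real d - 1)) ^ d"
      using b assms(3,5) by (intro mult_left_mono power_mono) auto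
    also have "\<dots> = 4 powr (real (d - 1)) * 4 powr (real d * (1 / real d - 1))"
      by (simp add: powr_realpow powr_power mult.commute)
    also have "\<dots> = 1"
      using assms(1) by (simp add: of_nat_diff right_diff_distrib flip: powr_add)
    finally show "2 ^ (d - 1) * c \<le> 1"
      using power2_le_imp_le[of "2 ^ (d - 1) * c" 1] by simp
    have "(s ^ d)\<^sup>2 = s ^ d * s ^ d" by (rule power2_eq_square)
    also have "\<dots> \<le> s ^ d * ?b ^ d"
      using assms(3,4) by (intro mult_left_mono power_mono) auto
    also have "\<dots> = c\<^sup>2" by (simp add: c(2) power_mult_distrib)
    finally show "s ^ d \<le> c"
      by (rule power2_le_imp_le) (use c(1) in simp)
    have c_pow: "c ^ (2 * (d - 1)) = (s * ?b) ^ (d * (d - 1))"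
      by (simp only: power_mult c(2))
    have "D * c ^ (2 * (d - 1)) * 2 ^ (d * (d - 1))
        = s ^ (d * (d - 1)) * (D * (2 * ?b) ^ (d * (d - 1)))"
      unfolding c_pow power_mult_distrib by (simp only: mult_ac)
    also have "\<dots> = s ^ (d * (d - 1)) * real d ^ d"
      by (simp only: radius_bound_power[OF assms(1,2)])
    finally have "D * c ^ (2 * (d - 1)) = s ^ (d * (d - 1)) * real d ^ d / 2 ^ (d * (d - 1))"
      by (simp only: eq_divide_eq) simp
    also have "\<dots> = s ^ (d * (d - 1)) * (real d / 2 ^ (d - 1)) ^ d"
      by (simp add: power_divide mult.commute[of d] flip: power_mult)
    finally show "D * c ^ (2 * (d - 1)) = s ^ (d * (d - 1)) * (real d / 2 ^ (d - 1)) ^ d" .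
  qed
qed

lemma max_radius_properties:
  assumes "d \<ge> 2" "D > 0"
  shows "is_largest (disk_radii d D) (max_radius d D)"
    and "is_largest (crossing_radii d D) (max_radius d D)"
    and "max_radius d D > 0"
    and "max_radius d D \<le> radius_bound d D"
    and "min (radius_bound d D) (4 powr (1 / real d - 1) / radius_bound d D) \<le> max_radius d D"
proof -
  let ?b = "radius_bound d D"
  have b: "?b > 0" by (rule radius_bound_pos[OF assms])
  \<comment> \<open>The largest \<open>s\<close> allowed by both constraints. It also provides the
    positive crossing radius on which existence of the maximum rests.\<close>
  let ?s = "min ?b (4 powr (1 / real d - 1) / ?b)"
  have s: "?s > 0" "?s \<le> ?b" "?s * ?b \<le> 4 powr (1 / real d - 1)"
    using b by (auto simp: min_def field_simps)
  then obtain r where r: "r \<in> crossing_radii d D" "r \<ge> ?s"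
    using ex_crossing_radius_of_bound[OF assms] by blast
  then have "r > 0" using s(1) by linarith
  note largest = is_largest_max_radius[OF assms(1) this r(1)]
  show "is_largest (disk_radii d D) (max_radius d D)" "is_largest (crossing_radii d D) (max_radius d D)"
    "max_radius d D > 0"
    by (fact largest)+
  show "max_radius d D \<le> ?b"
    using crossing_radius_le_bound[OF assms] largest by (simp add: is_largest_def)
  show "?s \<le> max_radius d D"
    using r largest(2) unfolding is_largest_def by (meson order_trans)
qed

section \<open>Explicit bounds for moderate discriminants and the limits as the degree grows\<close>

text \<open>From \<open>1 \<le> D\<close> follows \<open>?b \<le> ?u\<close>. The upper bound on
  \<open>D\<close> means \<open>4 powr (1 / real d - 1) \<le> ?b * ?b\<close>, so the second entry
  of the minimum is the smaller one; replacing \<open>?b\<close> by \<open>?u\<close> in it gives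
  the stated lower bound.\<close>

lemma max_radius_bounds_moderate_discr:
  assumes "d \<ge> 2" "1 \<le> D" "D \<le> 2 powr (1 - real d) * real d ^ d"
  shows "2 powr (- 1 + 2 / real d) * real d powr (- 1 / (real d - 1)) \<le> max_radius d D"
    and "max_radius d D \<le> real d powr (1 / (real d - 1)) / 2"
proof -
  let ?b = "radius_bound d D"
  let ?u = "real d powr (1 / (real d - 1)) / 2"
  let ?N = "d * (d - 1)"
  have D: "D > 0" using assms(2) by simp
  have b: "?b > 0" by (rule radius_bound_pos[OF assms(1) D])
  have u: "?u > 0" using assms(1) by simp
  have "1 \<le> D powr (1 / (real d * (real d - 1)))"
    using assms by (intro ge_one_powr_ge_zero) auto
  then have "?u / D powr (1 / (real d * (real d - 1))) \<le> ?u / 1"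
    using u by (intro divide_left_mono) auto
  then have bu: "?b \<le> ?u" by (simp add: radius_bound_def)
  then show "max_radius d D \<le> ?u"
    using max_radius_properties(4)[OF assms(1) D] by linarith
  have N: "real ?N = real d * (real d - 1)"
    using assms(1) by (simp add: of_nat_diff)
  \<comment> \<open>Writing \<open>2 powr (real d - 1)\<close> as an \<open>?N\<close>-th power lets
    the hypothesis on \<open>D\<close> be compared with \<open>2 * ?b\<close> by taking
    roots.\<close>
  have "(2 powr (1 / real d)) ^ ?N = 2 powr (real d - 1)"
    using assms(1) by (simp add: powr_power N)
  also have "D * \<dots> \<le> real d ^ d"
    using mult_right_mono[OF assms(3), of "2 powr (real d - 1)"] by (simp flip: powr_add add: mult_ac)
  then have "2 powr (real d - 1) \<le> (2 * ?b) ^ ?N"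
    unfolding radius_bound_power[OF assms(1) D, symmetric] using D by simp
  finally have "2 powr (1 / real d) \<le> 2 * ?b"
    using assms(1) b by (subst (asm) power_mono_iff) auto
  then have "(2 powr (1 / real d))\<^sup>2 \<le> (2 * ?b)\<^sup>2"
    by (intro power_mono) auto
  then have "4 powr (1 / real d) \<le> 4 * (?b * ?b)"
    by (simp add: power2_eq_square flip: powr_mult)
  then have "4 powr (1 / real d - 1) \<le> ?b * ?b"
    by (simp add: powr_diff)
  then have "4 powr (1 / real d - 1) / ?b \<le> ?b"
    using b by (simp add: divide_le_eq)
  then have "4 powr (1 / real d - 1) / ?b \<le> max_radius d D"
    using max_radius_properties(5)[OF assms(1) D] by simp
  moreover have "4 powr (1 / real d - 1) / ?u \<le> 4 powr (1 / real d - 1) / ?b"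
    using b u bu by (intro divide_left_mono mult_pos_pos) auto
  moreover have "4 powr (1 / real d - 1) / ?u = 2 powr (- 1 + 2 / real d) * real d powr (- 1 / (real d - 1))"
  proof -
    have "(4::real) powr (1 / real d - 1) = (2 powr 2) powr (1 / real d - 1)" by simp
    also have "\<dots> = 2 powr (- 1 + 2 / real d - 1)"
      unfolding powr_powr by (simp add: algebra_simps)
    also have "\<dots> = 2 powr (- 1 + 2 / real d) / 2"
      by (subst powr_diff) simp
    finally show ?thesis by (simp add: powr_minus divide_simps)
  qed
  ultimately show "2 powr (- 1 + 2 / real d) * real d powr (- 1 / (real d - 1)) \<le> max_radius d D"
    by simp
qed

text \<open>Isolates \<open>ln D / (real d)\<^sup>2\<close>, the quantity on which both limit
  hypotheses are stated; the other terms have limits 0 and 1.\<close>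

lemma radius_bound_exp:
  assumes "d \<ge> 2" "D > 0"
  shows "radius_bound d D
    = exp (ln (real d) / (real d - 1) - ln D / (real d)\<^sup>2 * (real d / (real d - 1))) / 2"
proof -
  have "ln D / (real d)\<^sup>2 * (real d / (real d - 1)) = ln D / (real d * (real d - 1))"
    using assms(1) by (simp add: power2_eq_square)
  then show ?thesis
    using assms by (simp add: radius_bound_def powr_def exp_diff)
qed

text \<open>Squeezing: the upper bound tends to 1/2, and the second entry of the minimum tends to
  (1/4) / (1/2), which is 1/2 as well.\<close>

lemma max_radius_tendsto_half:
  assumes "\<And>d. d \<ge> 2 \<Longrightarrow> D d > 0" and lim: "(\<lambda>d. \<bar>ln (D d)\<bar> / (real d)\<^sup>2) \<longlonglongrightarrow> 0"
  shows "(\<lambda>d. max_radius d (D d)) \<longlonglongrightarrow> 1 / 2"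
proof -
  let ?b = "\<lambda>d. radius_bound d (D d)"
  have ev: "\<forall>\<^sub>F d in sequentially. d \<ge> (2::nat)" by (rule eventually_ge_at_top)
  have "(\<lambda>d. ln (D d) / (real d)\<^sup>2) \<longlonglongrightarrow> 0"
    by (rule tendsto_rabs_zero_cancel) (use lim in simp)
  moreover have "(\<lambda>d. ln (real d) / (real d - 1)) \<longlonglongrightarrow> 0" "(\<lambda>d. real d / (real d - 1)) \<longlonglongrightarrow> 1"
    by real_asymp+
  ultimately have "(\<lambda>d. exp (ln (real d) / (real d - 1)
      - ln (D d) / (real d)\<^sup>2 * (real d / (real d - 1))) / 2) \<longlonglongrightarrow> exp (0 - 0 * 1) / 2"
    by (intro tendsto_intros) auto
  then have "?b \<longlonglongrightarrow> exp (0 - 0 * 1) / 2"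
    by (rule Lim_transform_eventually)
       (use ev in \<open>eventually_elim, use assms(1) radius_bound_exp in simp\<close>)
  then have b: "?b \<longlonglongrightarrow> 1 / 2" by simp
  have "(\<lambda>d. (4::real) powr (1 / real d - 1)) \<longlonglongrightarrow> 4 powr (0 - 1)"
    by (intro tendsto_intros lim_1_over_n) auto
  then have "(\<lambda>d. (4::real) powr (1 / real d - 1)) \<longlonglongrightarrow> 1 / 4"
    by simp
  then have "(\<lambda>d. min (?b d) (4 powr (1 / real d - 1) / ?b d)) \<longlonglongrightarrow> min (1 / 2) ((1 / 4) / (1 / 2))"
    using b by (intro tendsto_intros) auto
  then have lower: "(\<lambda>d. min (?b d) (4 powr (1 / real d - 1) / ?b d)) \<longlonglongrightarrow> 1 / 2"
    by simp
  show ?thesis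
  proof (rule tendsto_sandwich[OF _ _ lower b])
    show "\<forall>\<^sub>F d in sequentially. min (?b d) (4 powr (1 / real d - 1) / ?b d) \<le> max_radius d (D d)"
      using ev by eventually_elim (rule max_radius_properties(5)[OF _ assms(1)])
    show "\<forall>\<^sub>F d in sequentially. max_radius d (D d) \<le> ?b d"
      using ev by eventually_elim (rule max_radius_properties(4)[OF _ assms(1)])
  qed
qed

text \<open>The exponent in \<open>radius_bound_exp\<close> tends to minus infinity, so the upper
  bound tends to 0; positivity of the radius is the lower bound.\<close>

lemma max_radius_tendsto_zero:
  assumes "\<And>d. d \<ge> 2 \<Longrightarrow> D d > 0"
    and lim: "filterlim (\<lambda>d. ln (D d) / (real d)\<^sup>2) at_top sequentially"
  shows "(\<lambda>d. max_radius d (D d)) \<longlonglongrightarrow> 0"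
proof -
  let ?b = "\<lambda>d. radius_bound d (D d)"
  let ?f = "\<lambda>d. ln (D d) / (real d)\<^sup>2 * (real d / (real d - 1))"
  have ev: "\<forall>\<^sub>F d in sequentially. d \<ge> (2::nat)" by (rule eventually_ge_at_top)
  have lims: "(\<lambda>d. ln (real d) / (real d - 1)) \<longlonglongrightarrow> 0" "(\<lambda>d. real d / (real d - 1)) \<longlonglongrightarrow> 1"
    by real_asymp+
  have "filterlim ?f at_top sequentially"
    using filterlim_tendsto_pos_mult_at_top[OF lims(2) _ lim] by (simp add: mult.commute)
  then have "filterlim (\<lambda>d. - ?f d) at_bot sequentially"
    by (simp add: filterlim_uminus_at_bot)
  then have "filterlim (\<lambda>d. ln (real d) / (real d - 1) + - ?f d) at_bot sequentially"
    by (rule filterlim_tendsto_add_at_bot_iff[OF lims(1), THEN iffD2])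
  then have "(\<lambda>d. exp (ln (real d) / (real d - 1) - ?f d)) \<longlonglongrightarrow> 0"
    unfolding diff_conv_add_uminus by (rule filterlim_compose[OF exp_at_bot])
  then have "(\<lambda>d. exp (ln (real d) / (real d - 1) - ?f d) / 2) \<longlonglongrightarrow> 0"
    by (rule tendsto_divide_zero)
  then have b: "?b \<longlonglongrightarrow> 0"
    by (rule Lim_transform_eventually)
       (use ev in \<open>eventually_elim, use assms(1) radius_bound_exp in simp\<close>)
  show ?thesis
  proof (rule tendsto_sandwich[OF _ _ tendsto_const b])
    show "\<forall>\<^sub>F d in sequentially. 0 \<le> max_radius d (D d)"
      using ev by eventually_elim (rule less_imp_le[OF max_radius_properties(3)[OF _ assms(1)]])
    show "\<forall>\<^sub>F d in sequentially. max_radius d (D d) \<le> ?b d"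
      using ev by eventually_elim (rule max_radius_properties(4)[OF _ assms(1)])
  qed
qed

theorem theorem8:
  "(\<forall>(d::nat) (D::real). d \<ge> 2 \<and> D > 0 \<longrightarrow>
      is_largest (disk_radii d D) (max_radius d D) \<and>
      is_largest {r. \<exists>f\<in>K d D. cmod (poly (map_poly complex_of_real f) (complex_of_real r * \<i>)) = 1}
        (max_radius d D) \<and>
      max_radius d D
        \<le> real d powr (1 / (real d - 1)) / (2 * D powr (1 / (real d * (real d - 1))))) \<and>
   (\<forall>(d::nat) (D::real). d \<ge> 2 \<and> 1 \<le> D \<and> D \<le> 2 powr (1 - real d) * real d ^ d \<longrightarrow>
      2 powr (- 1 + 2 / real d) * real d powr (- 1 / (real d - 1)) \<le> max_radius d D \<and>
      max_radius d D \<le> real d powr (1 / (real d - 1)) / 2) \<and>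
   (\<forall>D :: nat \<Rightarrow> real. (\<forall>d\<ge>2. D d > 0) \<and>
      (\<lambda>d. \<bar>ln (D d)\<bar> / (real d)\<^sup>2) \<longlonglongrightarrow> 0 \<longrightarrow>
      (\<lambda>d. max_radius d (D d)) \<longlonglongrightarrow> 1 / 2) \<and>
   (\<forall>D :: nat \<Rightarrow> real. (\<forall>d\<ge>2. D d > 0) \<and>
      filterlim (\<lambda>d. ln (D d) / (real d)\<^sup>2) at_top sequentially \<longrightarrow>
      (\<lambda>d. max_radius d (D d)) \<longlonglongrightarrow> 0)"
proof (intro conjI allI impI; (elim conjE)?)
  fix d :: nat and D :: real
  assume d: "2 \<le> d"
  {
    assume D: "0 < D"
    note P = max_radius_properties[OF d D]
    show "is_largest (disk_radii d D) (max_radius d D)"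
      by (rule P)
    show "is_largest {r. \<exists>f\<in>K d D. cmod (poly (map_poly complex_of_real f) (complex_of_real r * \<i>)) = 1}
        (max_radius d D)"
      unfolding crossing_radii_eq by (rule P)
    show "max_radius d D \<le> real d powr (1 / (real d - 1)) / (2 * D powr (1 / (real d * (real d - 1))))"
      using P(4) by (simp only: radius_bound_def)
  }
  assume "1 \<le> D" "D \<le> 2 powr (1 - real d) * real d ^ d"
  note P = max_radius_bounds_moderate_discr[OF d this]
  show "2 powr (- 1 + 2 / real d) * real d powr (- 1 / (real d - 1)) \<le> max_radius d D"
    "max_radius d D \<le> real d powr (1 / (real d - 1)) / 2"
    by (rule P)+
next
  fix D :: "nat \<Rightarrow> real"
  assume D: "\<forall>d\<ge>2. D d > 0"
  show "(\<lambda>d. max_radius d (D d)) \<longlonglongrightarrow> 1 / 2"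
    if "(\<lambda>d. \<bar>ln (D d)\<bar> / (real d)\<^sup>2) \<longlonglongrightarrow> 0"
    using D that by (intro max_radius_tendsto_half) auto
  show "(\<lambda>d. max_radius d (D d)) \<longlonglongrightarrow> 0"
    if "filterlim (\<lambda>d. ln (D d) / (real d)\<^sup>2) at_top sequentially"
    using D that by (intro max_radius_tendsto_zero) auto
qed

end
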